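(* (Permutability theorem) Let $\lambda$ be a real parameter and let $(w_0,y_0)$ be a solution of the system $$w_t+\tfrac12w_x^2+w_{xxx}+\tfrac12\lambda y_x^2=0,\qquad y_t+w_xy_x+y_{xxx}=0. \quad (\ast)$$ Let $(w_{12},y_{12})$ be the solution of $(\ast)$ obtained from the Bäcklund transformation following the sequence $$(w_0,y_0)\to_{\eta_1}(w_1,y_1)\to_{\eta_2}(w_{12},y_{12})$$ and $(w_{21},y_{21})$ the solution of $(\ast)$ obtained following the sequence $$(w_0,y_0)\to_{\eta_2}(w_2,y_2)\to_{\eta_1}(w_{21},y_{21}).$$ Then $w_{12}=w_{21}$, $y_{12}=y_{21}$, and $$w_{12}-w_0=\frac{24(\eta_1-\eta_2)(w_1-w_2)}{(w_1-w_2)^2-\lambda(y_1-y_2)^2},\qquad y_{12}-y_0=\frac{-24(\eta_1-\eta_2)(y_1-y_2)}{(w_1-w_2)^2-\lambda(y_1-y_2)^2}.$$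
   Context: All functions are real-valued differentiable functions of $(x,t)$; subscripts $x,t$ denote partial derivatives, and $\eta_1,\eta_2$ are real parameters. For a real parameter $\eta$ and pairs $(w',y')$, $(w,y)$ (primes are not derivatives), $(w',y')\to_\eta(w,y)$ means that $(w,y)$ is obtained from $(w',y')$ by the Bäcklund transformation with parameter $\eta$ (and second parameter $\mu=0$), that is, the following equations hold: $$w_x+w'_x=2\eta-\tfrac1{12}(w-w')^2-\tfrac{\lambda}{12}(y-y')^2,$$ $$w_t+w'_t=\tfrac16(w-w')(w_{xx}-w'_{xx})+\tfrac{\lambda}6(y-y')(y_{xx}-y'_{xx})-\tfrac13w_x^2-\tfrac13{w'_x}^2-\tfrac13w_xw'_x-\tfrac\lambda3y_x^2-\tfrac\lambda3{y'_x}^2-\tfrac\lambda3y_xy'_x,$$ $$y_x+y'_x=-\tfrac16(w-w')(y-y'),$$ $$y_t+y'_t=\tfrac16(w-w')(y-y')_{xx}+\tfrac16(w-w')_{xx}(y-y')-\left(\tfrac23w_xy_x+\tfrac23w'_xy'_x+\tfrac13w_xy'_x+\tfrac13w'_xy_x\right).$$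
   Formalization: As integration constants are free, w12=w21, y12=y21 can fail; proved instead: the second steps can be chosen so that both sequences end in one solution given by the formulas, and the formulas hold whenever the ends agree; the denominator is assumed nonzero. *)

theory Defs
  imports "HOL-Analysis.Analysis"
begin

text \<open>
  Functions of \<open>(x, t)\<close> are functions on \<open>real \<times> real\<close>, considered on an open set \<open>S\<close> (solutions
  produced by the transformation may be singular, so they need not live on the whole plane).
\<close>

definition dx :: "(real \<times> real \<Rightarrow> real) \<Rightarrow> real \<times> real \<Rightarrow> real" where
  "dx f p = deriv (\<lambda>x. f (x, snd p)) (fst p)"

definition dt :: "(real \<times> real \<Rightarrow> real) \<Rightarrow> real \<times> real \<Rightarrow> real" where
  "dt f p = deriv (\<lambda>t. f (fst p, t)) (snd p)"

text \<open>
  Since \<open>deriv\<close> is total, the existence of the derivatives has to be required separately.  The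
  following ensures it for \<open>f\<^sub>x\<close>, \<open>f\<^sub>x\<^sub>x\<close>, \<open>f\<^sub>x\<^sub>x\<^sub>x\<close> and \<open>f\<^sub>t\<close>, the only derivatives that occur below.
\<close>

definition regular_on :: "(real \<times> real) set \<Rightarrow> (real \<times> real \<Rightarrow> real) \<Rightarrow> bool" where
  "regular_on S f \<longleftrightarrow>
     f differentiable_on S \<and> dx f differentiable_on S \<and> dx (dx f) differentiable_on S"

definition solution_on ::
  "real \<Rightarrow> (real \<times> real) set \<Rightarrow> (real \<times> real \<Rightarrow> real) \<Rightarrow> (real \<times> real \<Rightarrow> real) \<Rightarrow> bool" where
  "solution_on lam S w y \<longleftrightarrow>
     regular_on S w \<and> regular_on S y \<and>
     (\<forall>p\<in>S.
        dt w p + 1/2 * (dx w p)^2 + dx (dx (dx w)) p + 1/2 * lam * (dx y p)^2 = 0 \<and>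
        dt y p + dx w p * dx y p + dx (dx (dx y)) p = 0)"

text \<open>
  \<open>baecklund_on lam S \<eta> w' y' w y\<close> is \<open>(w', y') \<rightarrow>\<^sub>\<eta> (w, y)\<close> on \<open>S\<close>.  It is a relation: given
  \<open>(w', y')\<close> and \<open>\<eta>\<close>, \<open>(w, y)\<close> is determined only up to constants of integration.
\<close>

definition baecklund_on ::
  "real \<Rightarrow> (real \<times> real) set \<Rightarrow> real \<Rightarrow>
   (real \<times> real \<Rightarrow> real) \<Rightarrow> (real \<times> real \<Rightarrow> real) \<Rightarrow>
   (real \<times> real \<Rightarrow> real) \<Rightarrow> (real \<times> real \<Rightarrow> real) \<Rightarrow> bool" where
  "baecklund_on lam S \<eta> w' y' w y \<longleftrightarrow>
     regular_on S w' \<and> regular_on S y' \<and> regular_on S w \<and> regular_on S y \<and>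
     (\<forall>p\<in>S.
        dx w p + dx w' p = 2 * \<eta> - 1/12 * (w p - w' p)^2 - lam/12 * (y p - y' p)^2 \<and>
        dt w p + dt w' p =
          1/6 * (w p - w' p) * (dx (dx w) p - dx (dx w') p)
          + lam/6 * (y p - y' p) * (dx (dx y) p - dx (dx y') p)
          - 1/3 * (dx w p)^2 - 1/3 * (dx w' p)^2 - 1/3 * dx w p * dx w' p
          - lam/3 * (dx y p)^2 - lam/3 * (dx y' p)^2 - lam/3 * dx y p * dx y' p \<and>
        dx y p + dx y' p = - (1/6) * (w p - w' p) * (y p - y' p) \<and>
        dt y p + dt y' p =
          1/6 * (w p - w' p) * dx (dx (\<lambda>q. y q - y' q)) p
          + 1/6 * dx (dx (\<lambda>q. w q - w' q)) p * (y p - y' p)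
          - (2/3 * dx w p * dx y p + 2/3 * dx w' p * dx y' p
             + 1/3 * dx w p * dx y' p + 1/3 * dx w' p * dx y p))"

end

theory Submission
  imports Defs
begin

text \<open>
  Over the commutative algebra \<open>\<real>[j]\<close> with \<open>j\<^sup>2 = lam\<close>, the pair \<open>u = w + j y\<close> turns the system into
  the single potential KdV equation \<open>u\<^sub>t + u\<^sub>x\<^sup>2/2 + u\<^sub>x\<^sub>x\<^sub>x = 0\<close>, and the transformation into
  \<open>u\<^sub>x + u'\<^sub>x = 2\<eta> - (u - u')\<^sup>2/12\<close> together with its \<open>t\<close>-part.  The claimed formula reads
  \<open>(u\<^sub>1 - u\<^sub>2) (u\<^sub>1\<^sub>2 - u\<^sub>0) = 24 (\<eta>1 - \<eta>2)\<close>, where \<open>u\<^sub>1 - u\<^sub>2\<close> is invertible because its norm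
  \<open>(w1 - w2)\<^sup>2 - lam (y1 - y2)\<^sup>2\<close> does not vanish.  Combining the four \<open>x\<close>-equations of the square
  eliminates all derivatives and leaves exactly this formula.  Conversely, put
  \<open>D = u\<^sub>1 - u\<^sub>2\<close>, \<open>V = u\<^sub>1\<^sub>2 - u\<^sub>0\<close> and \<open>U = u\<^sub>1\<^sub>2 - u\<^sub>1 - u\<^sub>2 + u\<^sub>0\<close>.  The \<open>x\<close>-equations
  say \<open>D\<^sub>x = D U/12\<close> and \<open>V\<^sub>x = - V U/12\<close>, the \<open>t\<close>-equations say
  \<open>D\<^sub>t = D R\<close> and \<open>V\<^sub>t = - V R\<close> for a common \<open>R\<close>, and both pairs are
  compatible with \<open>D V\<close> being constant.  Finally, differentiating the \<open>x\<close>-equation twice and adding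
  the \<open>t\<close>-equation shows that a transform of a solution is a solution.
\<close>

section \<open>Pointwise algebra of the square, with derivatives as free variables\<close>

text \<open>Multiplying \<open>(a + j b) (X + j Y) = 0\<close> by the conjugate
  \<open>a - j b\<close> leaves the nonzero norm as the only factor.\<close>

lemma norm_form_cancel:
  fixes lam a b X Y :: real
  assumes "a^2 - lam * b^2 \<noteq> 0" "a * X + lam * b * Y = 0" "a * Y + b * X = 0"
  shows "X = 0" "Y = 0"
proof -
  have "X * (a^2 - lam * b^2) = 0" "Y * (a^2 - lam * b^2) = 0"
    using assms(2,3) by algebra+
  with assms(1) show "X = 0" "Y = 0" by auto
qed

text \<open>Index 3 stands for the corner 12. The constancy of \<open>D V\<close>, hypothesis
  \<open>c\<close>, and its \<open>x\<close>-derivative \<open>d\<close> give the missing equation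
  multiplied by \<open>D\<close>, which is then cancelled.\<close>

lemma permutability_algebra_x:
  fixes lam :: real
  assumes c: "(w1 - w2) * (w3 - w0) + lam * (y1 - y2) * (y3 - y0) = 24 * (\<eta>1 - \<eta>2)"
      "(w1 - w2) * (y3 - y0) + (y1 - y2) * (w3 - w0) = 0"
    and x: "w1x + w0x = 2 * \<eta>1 - 1/12 * (w1 - w0)^2 - lam/12 * (y1 - y0)^2"
      "y1x + y0x = - (1/6) * (w1 - w0) * (y1 - y0)"
      "w2x + w0x = 2 * \<eta>2 - 1/12 * (w2 - w0)^2 - lam/12 * (y2 - y0)^2"
      "y2x + y0x = - (1/6) * (w2 - w0) * (y2 - y0)"
    and d: "(w1 - w2) * (w3x - w0x) + (w3 - w0) * (w1x - w2x)
        + lam * ((y1 - y2) * (y3x - y0x) + (y3 - y0) * (y1x - y2x)) = 0"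
      "(w1 - w2) * (y3x - y0x) + (y3 - y0) * (w1x - w2x)
        + (y1 - y2) * (w3x - w0x) + (w3 - w0) * (y1x - y2x) = 0"
    and nz: "(w1 - w2)^2 - lam * (y1 - y2)^2 \<noteq> 0"
  shows "w3x + w1x = 2 * \<eta>2 - 1/12 * (w3 - w1)^2 - lam/12 * (y3 - y1)^2"
    and "y3x + y1x = - (1/6) * (w3 - w1) * (y3 - y1)"
proof -
  define X where "X = (w3x + w1x) - (2 * \<eta>2 - 1/12 * (w3 - w1)^2 - lam/12 * (y3 - y1)^2)"
  define Y where "Y = (y3x + y1x) - (- (1/6) * (w3 - w1) * (y3 - y1))"
  have "(w1 - w2) * X + lam * (y1 - y2) * Y = 0" "(w1 - w2) * Y + (y1 - y2) * X = 0"
    unfolding X_def Y_def using c x d by algebra+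
  from norm_form_cancel[OF nz this]
  show "w3x + w1x = 2 * \<eta>2 - 1/12 * (w3 - w1)^2 - lam/12 * (y3 - y1)^2"
    and "y3x + y1x = - (1/6) * (w3 - w1) * (y3 - y1)"
    by (simp_all add: X_def Y_def)
qed

text \<open>\<open>P + j Q\<close> is the common \<open>R\<close> of \<open>D\<^sub>t = D R\<close>
  and \<open>V\<^sub>t = - V R\<close>. The hypotheses eliminate every derivative except
  \<open>w0x\<close>, \<open>y0x\<close>, \<open>w1x\<close>, \<open>y1x\<close>,
  \<open>w0xx\<close>, \<open>y0xx\<close>; what remains are polynomial identities.\<close>

lemma permutability_algebra_t_factor:
  fixes lam :: real
  assumes W: "W = w3 - w1 - w2 + w0" "Y = y3 - y1 - y2 + y0"
    and w3x: "w3x = w0x - ((w3 - w0) * W + lam * (y3 - y0) * Y) / 12"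
      "y3x = y0x - ((w3 - w0) * Y + (y3 - y0) * W) / 12"
    and w2x: "w2x = w1x - ((w1 - w2) * W + lam * (y1 - y2) * Y) / 12"
      "y2x = y1x - ((w1 - w2) * Y + (y1 - y2) * W) / 12"
    and xx:
      "w1xx = - (1/6) * ((w1 - w0) * (w1x - w0x) + lam * (y1 - y0) * (y1x - y0x)) - w0xx"
      "y1xx = - (1/6) * ((w1 - w0) * (y1x - y0x) + (w1x - w0x) * (y1 - y0)) - y0xx"
      "w2xx = - (1/6) * ((w2 - w0) * (w2x - w0x) + lam * (y2 - y0) * (y2x - y0x)) - w0xx"
      "y2xx = - (1/6) * ((w2 - w0) * (y2x - y0x) + (w2x - w0x) * (y2 - y0)) - y0xx"
      "w3xx = - (1/6) * ((w3 - w1) * (w3x - w1x) + lam * (y3 - y1) * (y3x - y1x)) - w1xx"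
      "y3xx = - (1/6) * ((w3 - w1) * (y3x - y1x) + (w3x - w1x) * (y3 - y1)) - y1xx"
    and T:
      "R1 = 1/6 * (w1 - w0) * (w1xx - w0xx) + lam/6 * (y1 - y0) * (y1xx - y0xx)
        - 1/3 * w1x^2 - 1/3 * w0x^2 - 1/3 * w1x * w0x
        - lam/3 * y1x^2 - lam/3 * y0x^2 - lam/3 * y1x * y0x"
      "S1 = 1/6 * (w1 - w0) * (y1xx - y0xx) + 1/6 * (w1xx - w0xx) * (y1 - y0)
        - (2/3 * w1x * y1x + 2/3 * w0x * y0x + 1/3 * w1x * y0x + 1/3 * w0x * y1x)"
      "R2 = 1/6 * (w2 - w0) * (w2xx - w0xx) + lam/6 * (y2 - y0) * (y2xx - y0xx)
        - 1/3 * w2x^2 - 1/3 * w0x^2 - 1/3 * w2x * w0x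
        - lam/3 * y2x^2 - lam/3 * y0x^2 - lam/3 * y2x * y0x"
      "S2 = 1/6 * (w2 - w0) * (y2xx - y0xx) + 1/6 * (w2xx - w0xx) * (y2 - y0)
        - (2/3 * w2x * y2x + 2/3 * w0x * y0x + 1/3 * w2x * y0x + 1/3 * w0x * y2x)"
      "R3 = 1/6 * (w3 - w1) * (w3xx - w1xx) + lam/6 * (y3 - y1) * (y3xx - y1xx)
        - 1/3 * w3x^2 - 1/3 * w1x^2 - 1/3 * w3x * w1x
        - lam/3 * y3x^2 - lam/3 * y1x^2 - lam/3 * y3x * y1x"
      "S3 = 1/6 * (w3 - w1) * (y3xx - y1xx) + 1/6 * (w3xx - w1xx) * (y3 - y1)
        - (2/3 * w3x * y3x + 2/3 * w1x * y1x + 1/3 * w3x * y1x + 1/3 * w1x * y3x)"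
  shows "\<exists>P Q. R1 - R2 = (w1 - w2) * P + lam * (y1 - y2) * Q \<and>
    S1 - S2 = (w1 - w2) * Q + (y1 - y2) * P \<and>
    R3 - R1 = - ((w3 - w0) * P + lam * (y3 - y0) * Q) \<and>
    S3 - S1 = - ((w3 - w0) * Q + (y3 - y0) * P)"
proof -
  define u v m n A B where uv: "u = w1 - w0" "v = y1 - y0" "m = w2 - w0" "n = y2 - y0"
     "A = w3 - w0" "B = y3 - y0"
  have w: "w1 = w0 + u" "y1 = y0 + v" "w2 = w0 + m" "y2 = y0 + n" "w3 = w0 + A" "y3 = y0 + B"
    by (simp_all add: uv)
  \<comment> \<open>\<open>P + j Q\<close> is the quotient of \<open>(u\<^sub>1 - u\<^sub>2)\<^sub>t\<close> by \<open>u\<^sub>1 - u\<^sub>2\<close>, computed from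
     \<open>u\<^sub>2\<^sub>x = u\<^sub>1\<^sub>x - (u\<^sub>1 - u\<^sub>2) (W + j Y) / 12\<close>.\<close>
  define P where "P = - w0xx/3 - ((u+m)*(w1x-w0x) + lam*(v+n)*(y1x-y0x))/36
    - ((m^2+lam*n^2)*W + 2*lam*m*n*Y)/432
    - ((w1x-w0x+w2x-w0x)*W + lam*(y1x-y0x+y2x-y0x)*Y)/36 - (w0x*W+lam*y0x*Y)/12"
  define Q where "Q = - y0xx/3 - ((u+m)*(y1x-y0x) + (v+n)*(w1x-w0x))/36
    - ((m^2+lam*n^2)*Y + 2*m*n*W)/432
    - ((y1x-y0x+y2x-y0x)*W + (w1x-w0x+w2x-w0x)*Y)/36 - (w0x*Y+y0x*W)/12"
  note defs = T xx w3x w2x P_def Q_def W w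
  note distribs = power2_eq_square algebra_simps add_divide_distrib diff_divide_distrib
  have 1: "R1 - R2 = (w1 - w2) * P + lam * (y1 - y2) * Q" unfolding defs by (simp add: distribs)
  have 2: "S1 - S2 = (w1 - w2) * Q + (y1 - y2) * P" unfolding defs by (simp add: distribs)
  have 3: "R3 - R1 = - ((w3 - w0) * P + lam * (y3 - y0) * Q)" unfolding defs by (simp add: distribs)
  have 4: "S3 - S1 = - ((w3 - w0) * Q + (y3 - y0) * P)" unfolding defs by (simp add: distribs)
  from 1 2 3 4 show ?thesis by blast
qed

lemma permutability_algebra_t:
  fixes lam :: real
  assumes c: "(w1 - w2) * (w3 - w0) + lam * (y1 - y2) * (y3 - y0) = 24 * (\<eta>1 - \<eta>2)"
      "(w1 - w2) * (y3 - y0) + (y1 - y2) * (w3 - w0) = 0"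
    and x: "w1x + w0x = 2 * \<eta>1 - 1/12 * (w1 - w0)^2 - lam/12 * (y1 - y0)^2"
      "y1x + y0x = - (1/6) * (w1 - w0) * (y1 - y0)"
      "w2x + w0x = 2 * \<eta>2 - 1/12 * (w2 - w0)^2 - lam/12 * (y2 - y0)^2"
      "y2x + y0x = - (1/6) * (w2 - w0) * (y2 - y0)"
      "w3x + w1x = 2 * \<eta>2 - 1/12 * (w3 - w1)^2 - lam/12 * (y3 - y1)^2"
      "y3x + y1x = - (1/6) * (w3 - w1) * (y3 - y1)"
    and xx:
      "w1xx = - (1/6) * ((w1 - w0) * (w1x - w0x) + lam * (y1 - y0) * (y1x - y0x)) - w0xx"
      "y1xx = - (1/6) * ((w1 - w0) * (y1x - y0x) + (w1x - w0x) * (y1 - y0)) - y0xx"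
      "w2xx = - (1/6) * ((w2 - w0) * (w2x - w0x) + lam * (y2 - y0) * (y2x - y0x)) - w0xx"
      "y2xx = - (1/6) * ((w2 - w0) * (y2x - y0x) + (w2x - w0x) * (y2 - y0)) - y0xx"
      "w3xx = - (1/6) * ((w3 - w1) * (w3x - w1x) + lam * (y3 - y1) * (y3x - y1x)) - w1xx"
      "y3xx = - (1/6) * ((w3 - w1) * (y3x - y1x) + (w3x - w1x) * (y3 - y1)) - y1xx"
    and t:
      "w1t + w0t = 1/6 * (w1 - w0) * (w1xx - w0xx) + lam/6 * (y1 - y0) * (y1xx - y0xx)
        - 1/3 * w1x^2 - 1/3 * w0x^2 - 1/3 * w1x * w0x
        - lam/3 * y1x^2 - lam/3 * y0x^2 - lam/3 * y1x * y0x"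
      "y1t + y0t = 1/6 * (w1 - w0) * (y1xx - y0xx) + 1/6 * (w1xx - w0xx) * (y1 - y0)
        - (2/3 * w1x * y1x + 2/3 * w0x * y0x + 1/3 * w1x * y0x + 1/3 * w0x * y1x)"
      "w2t + w0t = 1/6 * (w2 - w0) * (w2xx - w0xx) + lam/6 * (y2 - y0) * (y2xx - y0xx)
        - 1/3 * w2x^2 - 1/3 * w0x^2 - 1/3 * w2x * w0x
        - lam/3 * y2x^2 - lam/3 * y0x^2 - lam/3 * y2x * y0x"
      "y2t + y0t = 1/6 * (w2 - w0) * (y2xx - y0xx) + 1/6 * (w2xx - w0xx) * (y2 - y0)
        - (2/3 * w2x * y2x + 2/3 * w0x * y0x + 1/3 * w2x * y0x + 1/3 * w0x * y2x)"
    and d: "(w1 - w2) * (w3t - w0t) + (w3 - w0) * (w1t - w2t)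
        + lam * ((y1 - y2) * (y3t - y0t) + (y3 - y0) * (y1t - y2t)) = 0"
      "(w1 - w2) * (y3t - y0t) + (y3 - y0) * (w1t - w2t)
        + (y1 - y2) * (w3t - w0t) + (w3 - w0) * (y1t - y2t) = 0"
    and nz: "(w1 - w2)^2 - lam * (y1 - y2)^2 \<noteq> 0"
  shows "w3t + w1t = 1/6 * (w3 - w1) * (w3xx - w1xx) + lam/6 * (y3 - y1) * (y3xx - y1xx)
        - 1/3 * w3x^2 - 1/3 * w1x^2 - 1/3 * w3x * w1x
        - lam/3 * y3x^2 - lam/3 * y1x^2 - lam/3 * y3x * y1x" (is "_ = ?R")
    and "y3t + y1t = 1/6 * (w3 - w1) * (y3xx - y1xx) + 1/6 * (w3xx - w1xx) * (y3 - y1)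
        - (2/3 * w3x * y3x + 2/3 * w1x * y1x + 1/3 * w3x * y1x + 1/3 * w1x * y3x)" (is "_ = ?S")
proof -
  define W Y where WY: "W = w3 - w1 - w2 + w0" "Y = y3 - y1 - y2 + y0"
  \<comment> \<open>With \<open>U = W + j Y\<close> these are \<open>V\<^sub>x = - V U/12\<close>
    and \<open>D\<^sub>x = D U/12\<close>; \<open>c\<close> has removed the parameters.\<close>
  have x': "w3x = w0x - ((w3 - w0) * W + lam * (y3 - y0) * Y) / 12"
      "y3x = y0x - ((w3 - w0) * Y + (y3 - y0) * W) / 12"
      "w2x = w1x - ((w1 - w2) * W + lam * (y1 - y2) * Y) / 12"
      "y2x = y1x - ((w1 - w2) * Y + (y1 - y2) * W) / 12"
    using c x unfolding WY by algebra+
  \<comment> \<open>The known \<open>t\<close>-equations supply \<open>R1\<close>,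
    \<open>S1\<close>, \<open>R2\<close>, \<open>S2\<close>. The third is the goal, so
    \<open>refl\<close> takes its right-hand sides themselves as \<open>R3\<close>,
    \<open>S3\<close>.\<close>
  obtain P Q where
    "(w1t + w0t) - (w2t + w0t) = (w1 - w2) * P + lam * (y1 - y2) * Q"
    "(y1t + y0t) - (y2t + y0t) = (w1 - w2) * Q + (y1 - y2) * P"
    and R: "?R - (w1t + w0t) = - ((w3 - w0) * P + lam * (y3 - y0) * Q)"
    and S: "?S - (y1t + y0t) = - ((w3 - w0) * Q + (y3 - y0) * P)"
    using permutability_algebra_t_factor[OF WY x' xx t refl refl] by blast
  then have D: "w1t - w2t = (w1 - w2) * P + lam * (y1 - y2) * Q"
    "y1t - y2t = (w1 - w2) * Q + (y1 - y2) * P" by simp_all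
  \<comment> \<open>Inserting \<open>D\<^sub>t = D R\<close> into
    \<open>D V\<^sub>t + V D\<^sub>t = 0\<close> gives
    \<open>D (V\<^sub>t + V R) = 0\<close>.\<close>
  have "(w1 - w2) * (w3t - w0t + ((w3 - w0) * P + lam * (y3 - y0) * Q))
      + lam * (y1 - y2) * (y3t - y0t + ((w3 - w0) * Q + (y3 - y0) * P)) = 0"
    "(w1 - w2) * (y3t - y0t + ((w3 - w0) * Q + (y3 - y0) * P))
      + (y1 - y2) * (w3t - w0t + ((w3 - w0) * P + lam * (y3 - y0) * Q)) = 0"
    using d unfolding D by algebra+
  from norm_form_cancel[OF nz this] R S
  show "w3t + w1t = ?R" "y3t + y1t = ?S" by linarith+
qed

section \<open>Partial derivatives on an open set\<close>

lemma has_dx: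
  assumes "f differentiable_on S" "open S" "p \<in> S"
  shows "((\<lambda>x. f (x, snd p)) has_real_derivative dx f p) (at (fst p))"
proof -
  have "f differentiable at p"
    using assms by (metis differentiable_on_eq_differentiable_at)
  then have "f differentiable at (fst p, snd p)" by simp
  then have "(\<lambda>x. f (x, snd p)) differentiable at (fst p)"
    by (rule differentiable_compose) (auto simp: differentiable_def intro!: derivative_eq_intros exI)
  then show ?thesis
    unfolding dx_def by (simp add: DERIV_deriv_iff_real_differentiable)
qed

lemma has_dt:
  assumes "f differentiable_on S" "open S" "p \<in> S"
  shows "((\<lambda>t. f (fst p, t)) has_real_derivative dt f p) (at (snd p))"
proof -
  have "f differentiable at p"
    using assms by (metis differentiable_on_eq_differentiable_at)
  then have "f differentiable at (fst p, snd p)" by simp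
  then have "(\<lambda>t. f (fst p, t)) differentiable at (snd p)"
    by (rule differentiable_compose) (auto simp: differentiable_def intro!: derivative_eq_intros exI)
  then show ?thesis
    unfolding dt_def by (simp add: DERIV_deriv_iff_real_differentiable)
qed

text \<open>The tool for differentiating identities valid on \<open>S\<close>: the horizontal line
  through \<open>p\<close> meets \<open>S\<close> in an open set, so both restrictions agree near
  \<open>fst p\<close>.\<close>

lemma dx_unique:
  assumes "open S" "p \<in> S" "\<And>q. q \<in> S \<Longrightarrow> f q = g q"
    and "((\<lambda>x. f (x, snd p)) has_real_derivative D) (at (fst p))"
    and "((\<lambda>x. g (x, snd p)) has_real_derivative E) (at (fst p))"
  shows "D = E"
proof -
  have "open ((\<lambda>x. (x, snd p)) -` S)"
    by (intro open_vimage assms continuous_intros)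
  then have "((\<lambda>x. f (x, snd p)) has_real_derivative E) (at (fst p))"
    by (rule has_field_derivative_transform_within_open[OF assms(5)]) (use assms in auto)
  then show ?thesis using assms(4) by (rule DERIV_unique[rotated])
qed

lemma dt_unique:
  assumes "open S" "p \<in> S" "\<And>q. q \<in> S \<Longrightarrow> f q = g q"
    and "((\<lambda>t. f (fst p, t)) has_real_derivative D) (at (snd p))"
    and "((\<lambda>t. g (fst p, t)) has_real_derivative E) (at (snd p))"
  shows "D = E"
proof -
  have "open ((\<lambda>t. (fst p, t)) -` S)"
    by (intro open_vimage assms continuous_intros)
  then have "((\<lambda>t. f (fst p, t)) has_real_derivative E) (at (snd p))"
    by (rule has_field_derivative_transform_within_open[OF assms(5)]) (use assms in auto)
  then show ?thesis using assms(4) by (rule DERIV_unique[rotated])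
qed

lemma differentiable_on_congruent:
  assumes "\<And>q. q \<in> S \<Longrightarrow> f q = g q" "g differentiable_on S"
  shows "f differentiable_on S"
  using assms unfolding differentiable_on_def differentiable_def
  by (metis has_derivative_transform)

lemma regular_onD:
  assumes "regular_on S f"
  shows "f differentiable_on S" "dx f differentiable_on S" "dx (dx f) differentiable_on S"
  using assms by (simp_all add: regular_on_def)

section \<open>Regularity and higher \<open>x\<close>-derivatives of a transform\<close>

text \<open>
  Only differentiability of \<open>w\<close> and \<open>y\<close> is assumed: the \<open>x\<close>-equations express \<open>dx w\<close> and
  \<open>dx y\<close> by differentiable functions, so the remaining regularity can be bootstrapped.
\<close>

locale baecklund_x =
  fixes lam \<eta> :: real and S :: "(real \<times> real) set" and w' y' w y :: "real \<times> real \<Rightarrow> real"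
  assumes S: "open S"
    and reg': "regular_on S w'" "regular_on S y'"
    and diff: "w differentiable_on S" "y differentiable_on S"
    and wx: "p \<in> S \<Longrightarrow> dx w p + dx w' p
      = 2 * \<eta> - 1/12 * (w p - w' p)^2 - lam/12 * (y p - y' p)^2"
    and yx: "p \<in> S \<Longrightarrow> dx y p + dx y' p = - (1/6) * (w p - w' p) * (y p - y' p)"
begin

lemma wx': "p \<in> S \<Longrightarrow> dx w p
    = 2 * \<eta> - 1/12 * ((w p - w' p) * (w p - w' p)) - lam/12 * ((y p - y' p) * (y p - y' p)) - dx w' p"
  using wx[of p] unfolding power2_eq_square by linarith

lemma yx': "p \<in> S \<Longrightarrow> dx y p = - (1/6) * ((w p - w' p) * (y p - y' p)) - dx y' p"
  using yx[of p] by linarith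

lemmas [derivative_intros] = diff regular_onD[OF reg'(1)] regular_onD[OF reg'(2)]

lemma dx_differentiable [derivative_intros]:
  "dx w differentiable_on S" "dx y differentiable_on S"
  by (rule differentiable_on_congruent[OF wx'], assumption, intro derivative_intros)
     (rule differentiable_on_congruent[OF yx'], assumption, intro derivative_intros)

lemmas has_dx_funs = diff[THEN has_dx, OF S] regular_onD(1,2)[OF reg'(1), THEN has_dx, OF S]
  regular_onD(1,2)[OF reg'(2), THEN has_dx, OF S] dx_differentiable[THEN has_dx, OF S]

text \<open>Differentiating the solved \<open>x\<close>-equation leaves only first derivatives of
  \<open>w\<close> and \<open>y\<close> on the right; these are already differentiable, so the
  formula gives the next order of regularity.\<close>

lemma wxx: "dx (dx w) p = - (1/6) * ((w p - w' p) * (dx w p - dx w' p)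
      + lam * (y p - y' p) * (dx y p - dx y' p)) - dx (dx w') p" if p: "p \<in> S" for p
  by (rule dx_unique[OF S p wx' has_dx[OF dx_differentiable(1) S p]], assumption)
    (auto intro!: derivative_eq_intros has_dx_funs p simp: field_simps)

lemma yxx: "dx (dx y) p = - (1/6) * ((w p - w' p) * (dx y p - dx y' p)
      + (dx w p - dx w' p) * (y p - y' p)) - dx (dx y') p" if p: "p \<in> S" for p
  by (rule dx_unique[OF S p yx' has_dx[OF dx_differentiable(2) S p]], assumption)
    (auto intro!: derivative_eq_intros has_dx_funs p simp: field_simps)

lemma dx_dx_differentiable [derivative_intros]:
  "dx (dx w) differentiable_on S" "dx (dx y) differentiable_on S"
  by (rule differentiable_on_congruent[OF wxx], assumption, intro derivative_intros)
     (rule differentiable_on_congruent[OF yxx], assumption, intro derivative_intros)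

lemma regular: "regular_on S w" "regular_on S y"
  by (simp_all add: regular_on_def diff dx_differentiable dx_dx_differentiable)

lemmas has_dx_dx_funs = has_dx_funs regular_onD(3)[OF reg'(1), THEN has_dx, OF S]
  regular_onD(3)[OF reg'(2), THEN has_dx, OF S] dx_dx_differentiable[THEN has_dx, OF S]

lemma wxxx: "dx (dx (dx w)) p = - (1/6) * ((w p - w' p) * (dx (dx w) p - dx (dx w') p) + (dx w p - dx w' p)^2
      + lam * (y p - y' p) * (dx (dx y) p - dx (dx y') p) + lam * (dx y p - dx y' p)^2) - dx (dx (dx w')) p"
  if p: "p \<in> S" for p
  by (rule dx_unique[OF S p wxx has_dx[OF dx_dx_differentiable(1) S p]], assumption)
    (auto intro!: derivative_eq_intros has_dx_dx_funs p simp: field_simps power2_eq_square)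

lemma yxxx: "dx (dx (dx y)) p = - (1/6) * ((w p - w' p) * (dx (dx y) p - dx (dx y') p)
      + 2 * (dx w p - dx w' p) * (dx y p - dx y' p)
      + (dx (dx w) p - dx (dx w') p) * (y p - y' p)) - dx (dx (dx y')) p" if p: "p \<in> S" for p
  by (rule dx_unique[OF S p yxx has_dx[OF dx_dx_differentiable(2) S p]], assumption)
    (auto intro!: derivative_eq_intros has_dx_dx_funs p simp: field_simps)

end

section \<open>Transforms of solutions\<close>

text \<open>The last equation of \<open>baecklund_on\<close> differentiates the differences
  themselves; since \<open>deriv\<close> is total, splitting them rests on regularity.\<close>

lemma dx_dx_diff:
  assumes S: "open S" and "regular_on S f" "regular_on S g" and p: "p \<in> S"
  shows "dx (dx (\<lambda>q. f q - g q)) p = dx (dx f) p - dx (dx g) p"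
proof -
  note f = regular_onD[OF assms(2)] and g = regular_onD[OF assms(3)]
  have 1: "dx (\<lambda>q. f q - g q) q = dx f q - dx g q" if q: "q \<in> S" for q
    by (rule dx_unique[OF S q refl has_dx[OF _ S q]])
      (auto intro!: derivative_intros f g has_dx[OF _ S q])
  have 2: "dx (\<lambda>q. f q - g q) differentiable_on S"
    by (rule differentiable_on_congruent[OF 1]) (auto intro!: derivative_intros f g)
  show ?thesis
    by (rule dx_unique[OF S p 1 has_dx[OF 2 S p]])
      (auto intro!: derivative_intros f g has_dx[OF _ S p])
qed

lemma baecklund_on_iff:
  assumes "open S"
  shows "baecklund_on lam S \<eta> w' y' w y \<longleftrightarrow> baecklund_x lam \<eta> S w' y' w y \<and>
    (\<forall>p\<in>S. dt w p + dt w' p =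
          1/6 * (w p - w' p) * (dx (dx w) p - dx (dx w') p)
          + lam/6 * (y p - y' p) * (dx (dx y) p - dx (dx y') p)
          - 1/3 * (dx w p)^2 - 1/3 * (dx w' p)^2 - 1/3 * dx w p * dx w' p
          - lam/3 * (dx y p)^2 - lam/3 * (dx y' p)^2 - lam/3 * dx y p * dx y' p \<and>
        dt y p + dt y' p =
          1/6 * (w p - w' p) * (dx (dx y) p - dx (dx y') p)
          + 1/6 * (dx (dx w) p - dx (dx w') p) * (y p - y' p)
          - (2/3 * dx w p * dx y p + 2/3 * dx w' p * dx y' p
             + 1/3 * dx w p * dx y' p + 1/3 * dx w' p * dx y p))"
    (is "?L \<longleftrightarrow> ?X \<and> ?T")
proof
  assume L: ?L
  then have "regular_on S w'" "regular_on S y'" "regular_on S w" "regular_on S y"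
    by (auto simp: baecklund_on_def)
  with assms L show "?X \<and> ?T"
    by (auto simp: baecklund_x_def baecklund_on_def dx_dx_diff regular_onD(1))
next
  assume R: "?X \<and> ?T"
  then interpret baecklund_x lam \<eta> S w' y' w y by simp
  show ?L
    unfolding baecklund_on_def using R reg' regular wx yx
    by (simp add: dx_dx_diff[OF S])
qed

text \<open>Adding \<open>u\<^sub>x\<^sub>x\<^sub>x + u'\<^sub>x\<^sub>x\<^sub>x\<close> to the
  \<open>t\<close>-equation cancels the second-derivative and mixed terms and leaves
  \<open>- (u\<^sub>x\<^sup>2 + u'\<^sub>x\<^sup>2)/2\<close>, the sum of the equations for
  \<open>u\<close> and \<open>u'\<close>.\<close>

lemma baecklund_solution:
  assumes S: "open S" and b: "baecklund_on lam S \<eta> w' y' w y" and s: "solution_on lam S w' y'"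
  shows "solution_on lam S w y"
proof -
  note R = b[unfolded baecklund_on_iff[OF S]]
  then interpret baecklund_x lam \<eta> S w' y' w y by simp
  have "dt w p + 1/2 * (dx w p)^2 + dx (dx (dx w)) p + 1/2 * lam * (dx y p)^2 = 0"
    "dt y p + dx w p * dx y p + dx (dx (dx y)) p = 0" if p: "p \<in> S" for p
  proof -
    have s': "dt w' p + 1/2 * (dx w' p)^2 + dx (dx (dx w')) p + 1/2 * lam * (dx y' p)^2 = 0"
      "dt y' p + dx w' p * dx y' p + dx (dx (dx y')) p = 0"
      using s p by (auto simp: solution_on_def)
    note t = R[THEN conjunct2, rule_format, OF p]
    show "dt w p + 1/2 * (dx w p)^2 + dx (dx (dx w)) p + 1/2 * lam * (dx y p)^2 = 0"
      using t[THEN conjunct1] wxxx[OF p] s'(1) by algebra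
    show "dt y p + dx w p * dx y p + dx (dx (dx y)) p = 0"
      using t[THEN conjunct2] yxxx[OF p] s'(2) by algebra
  qed
  then show ?thesis by (simp add: solution_on_def regular)
qed

section \<open>The superposition formula\<close>

text \<open>These are the components of \<open>(a + j b) (A + j B) = K\<close>, solved by
  multiplying with \<open>a - j b\<close>.\<close>

lemma superposition_iff:
  fixes lam :: real
  assumes nz: "a^2 - lam * b^2 \<noteq> 0"
  shows "a * A + lam * b * B = K \<and> a * B + b * A = 0 \<longleftrightarrow>
    A = K * a / (a^2 - lam * b^2) \<and> B = - K * b / (a^2 - lam * b^2)"
proof -
  have "A * (a^2 - lam * b^2) = (a * A + lam * b * B) * a - (a * B + b * A) * (lam * b)"
    "B * (a^2 - lam * b^2) = (a * B + b * A) * a - (a * A + lam * b * B) * b"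
    by algebra+
  then have "A * (a^2 - lam * b^2) = K * a \<and> B * (a^2 - lam * b^2) = - K * b"
    if "a * A + lam * b * B = K" "a * B + b * A = 0"
    using that by simp
  moreover have "a * A + lam * b * B - K = 0 \<and> a * B + b * A - 0 = 0"
    if "A * (a^2 - lam * b^2) = K * a" "B * (a^2 - lam * b^2) = - K * b"
  proof -
    have "(a * A + lam * b * B - K) * (a^2 - lam * b^2) = 0"
      "(a * B + b * A) * (a^2 - lam * b^2) = 0"
      using that by algebra+
    with nz show ?thesis by simp
  qed
  ultimately show ?thesis
    by (simp only: nonzero_eq_divide_eq[OF nz]) auto
qed

lemma superposition_baecklund:
  assumes S: "open S"
    and b1: "baecklund_on lam S \<eta>1 w0 y0 w1 y1"
    and b2: "baecklund_on lam S \<eta>2 w0 y0 w2 y2"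
    and nz: "\<And>p. p \<in> S \<Longrightarrow> (w1 p - w2 p)^2 - lam * (y1 p - y2 p)^2 \<noteq> 0"
    and w3: "\<And>p. p \<in> S \<Longrightarrow> w3 p - w0 p = 24 * (\<eta>1 - \<eta>2) * (w1 p - w2 p)
      / ((w1 p - w2 p)^2 - lam * (y1 p - y2 p)^2)"
    and y3: "\<And>p. p \<in> S \<Longrightarrow> y3 p - y0 p = - 24 * (\<eta>1 - \<eta>2) * (y1 p - y2 p)
      / ((w1 p - w2 p)^2 - lam * (y1 p - y2 p)^2)"
  shows "baecklund_on lam S \<eta>2 w1 y1 w3 y3"
proof -
  note B1 = b1[unfolded baecklund_on_iff[OF S]] and B2 = b2[unfolded baecklund_on_iff[OF S]]
  interpret b1: baecklund_x lam \<eta>1 S w0 y0 w1 y1 using B1 by simp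
  interpret b2: baecklund_x lam \<eta>2 S w0 y0 w2 y2 using B2 by simp
  note d0 = regular_onD(1)[OF b1.reg'(1)] regular_onD(1)[OF b1.reg'(2)]
  have c: "(w1 p - w2 p) * (w3 p - w0 p) + lam * (y1 p - y2 p) * (y3 p - y0 p) = 24 * (\<eta>1 - \<eta>2)"
      "(w1 p - w2 p) * (y3 p - y0 p) + (y1 p - y2 p) * (w3 p - w0 p) = 0" if p: "p \<in> S" for p
    using superposition_iff[OF nz[OF p], of "w3 p - w0 p" "y3 p - y0 p" "24 * (\<eta>1 - \<eta>2)"]
      w3[OF p] y3[OF p] by simp_all
  have "(\<lambda>p. w0 p + 24 * (\<eta>1 - \<eta>2) * (w1 p - w2 p)
      / ((w1 p - w2 p)^2 - lam * (y1 p - y2 p)^2)) differentiable_on S"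
    using d0 b1.diff b2.diff nz unfolding differentiable_on_def by (auto intro!: derivative_intros)
  then have d3w: "w3 differentiable_on S"
    by (rule differentiable_on_congruent[rotated]) (use w3 in \<open>simp add: algebra_simps\<close>)
  have "(\<lambda>p. y0 p + - 24 * (\<eta>1 - \<eta>2) * (y1 p - y2 p)
      / ((w1 p - w2 p)^2 - lam * (y1 p - y2 p)^2)) differentiable_on S"
    using d0 b1.diff b2.diff nz unfolding differentiable_on_def by (auto intro!: derivative_intros)
  then have d3y: "y3 differentiable_on S"
    by (rule differentiable_on_congruent[rotated]) (use y3 in \<open>simp add: algebra_simps\<close>)
  note dx = has_dx[OF d0(1) S] has_dx[OF d0(2) S] b1.has_dx_funs b2.has_dx_funs
    has_dx[OF d3w S] has_dx[OF d3y S]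
  note dt = d0[THEN has_dt, OF S] b1.diff[THEN has_dt, OF S] b2.diff[THEN has_dt, OF S]
    has_dt[OF d3w S] has_dt[OF d3y S]
  \<comment> \<open>The Leibniz rule for the constant product \<open>D V\<close>, in
    components.\<close>
  have cx: "(w1 p - w2 p) * (dx w3 p - dx w0 p) + (w3 p - w0 p) * (dx w1 p - dx w2 p)
        + lam * ((y1 p - y2 p) * (dx y3 p - dx y0 p) + (y3 p - y0 p) * (dx y1 p - dx y2 p)) = 0" (is "?x1")
      "(w1 p - w2 p) * (dx y3 p - dx y0 p) + (y3 p - y0 p) * (dx w1 p - dx w2 p)
        + (y1 p - y2 p) * (dx w3 p - dx w0 p) + (w3 p - w0 p) * (dx y1 p - dx y2 p) = 0" (is "?x2")
    if p: "p \<in> S" for p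
  proof -
    show "?x1"
      by (rule dx_unique[OF S p c(1) _ DERIV_const], assumption)
        (auto intro!: derivative_eq_intros dx p simp: algebra_simps)
    show "?x2"
      by (rule dx_unique[OF S p c(2) _ DERIV_const], assumption)
        (auto intro!: derivative_eq_intros dx p simp: algebra_simps)
  qed
  have ct: "(w1 p - w2 p) * (dt w3 p - dt w0 p) + (w3 p - w0 p) * (dt w1 p - dt w2 p)
        + lam * ((y1 p - y2 p) * (dt y3 p - dt y0 p) + (y3 p - y0 p) * (dt y1 p - dt y2 p)) = 0" (is "?t1")
      "(w1 p - w2 p) * (dt y3 p - dt y0 p) + (y3 p - y0 p) * (dt w1 p - dt w2 p)
        + (y1 p - y2 p) * (dt w3 p - dt w0 p) + (w3 p - w0 p) * (dt y1 p - dt y2 p) = 0" (is "?t2")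
    if p: "p \<in> S" for p
  proof -
    show "?t1"
      by (rule dt_unique[OF S p c(1) _ DERIV_const], assumption)
        (auto intro!: derivative_eq_intros dt p simp: algebra_simps)
    show "?t2"
      by (rule dt_unique[OF S p c(2) _ DERIV_const], assumption)
        (auto intro!: derivative_eq_intros dt p simp: algebra_simps)
  qed
  \<comment> \<open>The \<open>x\<close>-equations come first: through the locale they provide the
    second derivatives of \<open>w3\<close>, \<open>y3\<close> that enter the
    \<open>t\<close>-equations.\<close>
  interpret b3: baecklund_x lam \<eta>2 S w1 y1 w3 y3
    using permutability_algebra_x[OF c b1.wx b1.yx b2.wx b2.yx cx nz]
    by unfold_locales (simp_all add: S b1.regular d3w d3y)
  show ?thesis
    unfolding baecklund_on_iff[OF S]
  proof (intro conjI ballI)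
    fix p assume p: "p \<in> S"
    note t1 = B1[THEN conjunct2, rule_format, OF p] and t2 = B2[THEN conjunct2, rule_format, OF p]
    note eqs = permutability_algebra_t[OF c[OF p] b1.wx[OF p] b1.yx[OF p] b2.wx[OF p] b2.yx[OF p]
        b3.wx[OF p] b3.yx[OF p] b1.wxx[OF p] b1.yxx[OF p] b2.wxx[OF p] b2.yxx[OF p]
        b3.wxx[OF p] b3.yxx[OF p] t1[THEN conjunct1] t1[THEN conjunct2]
        t2[THEN conjunct1] t2[THEN conjunct2] ct[OF p] nz[OF p]]
    show "dt w3 p + dt w1 p =
          1/6 * (w3 p - w1 p) * (dx (dx w3) p - dx (dx w1) p)
          + lam/6 * (y3 p - y1 p) * (dx (dx y3) p - dx (dx y1) p)
          - 1/3 * (dx w3 p)^2 - 1/3 * (dx w1 p)^2 - 1/3 * dx w3 p * dx w1 p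
          - lam/3 * (dx y3 p)^2 - lam/3 * (dx y1 p)^2 - lam/3 * dx y3 p * dx y1 p"
      by (rule eqs(1))
    show "dt y3 p + dt y1 p =
          1/6 * (w3 p - w1 p) * (dx (dx y3) p - dx (dx y1) p)
          + 1/6 * (dx (dx w3) p - dx (dx w1) p) * (y3 p - y1 p)
          - (2/3 * dx w3 p * dx y3 p + 2/3 * dx w1 p * dx y1 p
             + 1/3 * dx w3 p * dx y1 p + 1/3 * dx w1 p * dx y3 p)"
      by (rule eqs(2))
  qed (rule b3.baecklund_x_axioms)
qed

text \<open>In the alternating sum of the four \<open>x\<close>-equations around the square all
  derivatives cancel, leaving \<open>4 (\<eta>1 - \<eta>2) = D V/6\<close>, whence the factor
  24.\<close>

lemma baecklund_square_superposition:
  assumes S: "open S" and p: "p \<in> S"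
    and b: "baecklund_on lam S \<eta>1 w0 y0 w1 y1" "baecklund_on lam S \<eta>2 w0 y0 w2 y2"
      "baecklund_on lam S \<eta>2 w1 y1 w12 y12" "baecklund_on lam S \<eta>1 w2 y2 w21 y21"
    and eq: "\<forall>p\<in>S. w12 p = w21 p \<and> y12 p = y21 p"
    and nz: "(w1 p - w2 p)^2 - lam * (y1 p - y2 p)^2 \<noteq> 0"
  shows "w12 p - w0 p = 24 * (\<eta>1 - \<eta>2) * (w1 p - w2 p)
      / ((w1 p - w2 p)^2 - lam * (y1 p - y2 p)^2) \<and>
    y12 p - y0 p = - 24 * (\<eta>1 - \<eta>2) * (y1 p - y2 p)
      / ((w1 p - w2 p)^2 - lam * (y1 p - y2 p)^2)"
proof -
  interpret b1: baecklund_x lam \<eta>1 S w0 y0 w1 y1 using b(1) baecklund_on_iff[OF S] by blast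
  interpret b2: baecklund_x lam \<eta>2 S w0 y0 w2 y2 using b(2) baecklund_on_iff[OF S] by blast
  interpret b12: baecklund_x lam \<eta>2 S w1 y1 w12 y12 using b(3) baecklund_on_iff[OF S] by blast
  interpret b21: baecklund_x lam \<eta>1 S w2 y2 w21 y21 using b(4) baecklund_on_iff[OF S] by blast
  \<comment> \<open>Agreement on all of the open set \<open>S\<close> carries over to derivatives,
    so the fourth edge can be written with \<open>w12\<close>, \<open>y12\<close>.\<close>
  have "dx w12 p = dx w21 p" "dx y12 p = dx y21 p"
    using eq by (auto intro!: dx_unique[OF S p _ b12.has_dx_funs(1)[OF p] b21.has_dx_funs(1)[OF p]]
        dx_unique[OF S p _ b12.has_dx_funs(2)[OF p] b21.has_dx_funs(2)[OF p]])
  with b21.wx[OF p] b21.yx[OF p] eq p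
  have x21: "dx w12 p + dx w2 p = 2 * \<eta>1 - 1/12 * (w12 p - w2 p)^2 - lam/12 * (y12 p - y2 p)^2"
    "dx y12 p + dx y2 p = - (1/6) * (w12 p - w2 p) * (y12 p - y2 p)" by simp_all
  have "(w1 p - w2 p) * (w12 p - w0 p) + lam * (y1 p - y2 p) * (y12 p - y0 p) = 24 * (\<eta>1 - \<eta>2)"
    using b1.wx[OF p] b2.wx[OF p] b12.wx[OF p] x21(1) by algebra
  moreover have "(w1 p - w2 p) * (y12 p - y0 p) + (y1 p - y2 p) * (w12 p - w0 p) = 0"
    using b1.yx[OF p] b2.yx[OF p] b12.yx[OF p] x21(2) by algebra
  ultimately show ?thesis
    using superposition_iff[OF nz, of "w12 p - w0 p" "y12 p - y0 p" "24 * (\<eta>1 - \<eta>2)"] by simp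
qed

text \<open>Constants of integration may make the ends of the two sequences differ; hence the split
  into existence of a common end and the formula for every common end.\<close>

theorem theorem4:
  fixes lam \<eta>1 \<eta>2 :: real
    and S :: "(real \<times> real) set"
    and w0 y0 w1 y1 w2 y2 :: "real \<times> real \<Rightarrow> real"
  assumes "open S"
    and "solution_on lam S w0 y0"
    and "baecklund_on lam S \<eta>1 w0 y0 w1 y1"
    and "baecklund_on lam S \<eta>2 w0 y0 w2 y2"
    and "\<forall>p\<in>S. (w1 p - w2 p)^2 - lam * (y1 p - y2 p)^2 \<noteq> 0"
  shows
    "(\<exists>w12 y12 w21 y21.
        baecklund_on lam S \<eta>2 w1 y1 w12 y12 \<and> solution_on lam S w12 y12 \<and>
        baecklund_on lam S \<eta>1 w2 y2 w21 y21 \<and> solution_on lam S w21 y21 \<and>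
        (\<forall>p\<in>S. w12 p = w21 p \<and> y12 p = y21 p \<and>
          w12 p - w0 p = 24 * (\<eta>1 - \<eta>2) * (w1 p - w2 p)
                           / ((w1 p - w2 p)^2 - lam * (y1 p - y2 p)^2) \<and>
          y12 p - y0 p = - 24 * (\<eta>1 - \<eta>2) * (y1 p - y2 p)
                           / ((w1 p - w2 p)^2 - lam * (y1 p - y2 p)^2))) \<and>
     (\<forall>w12 y12 w21 y21.
        baecklund_on lam S \<eta>2 w1 y1 w12 y12 \<longrightarrow> solution_on lam S w12 y12 \<longrightarrow>
        baecklund_on lam S \<eta>1 w2 y2 w21 y21 \<longrightarrow> solution_on lam S w21 y21 \<longrightarrow>
        (\<forall>p\<in>S. w12 p = w21 p \<and> y12 p = y21 p) \<longrightarrow>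
        (\<forall>p\<in>S.
          w12 p - w0 p = 24 * (\<eta>1 - \<eta>2) * (w1 p - w2 p)
                           / ((w1 p - w2 p)^2 - lam * (y1 p - y2 p)^2) \<and>
          y12 p - y0 p = - 24 * (\<eta>1 - \<eta>2) * (y1 p - y2 p)
                           / ((w1 p - w2 p)^2 - lam * (y1 p - y2 p)^2)))"
proof -
  have nz: "(w1 p - w2 p)^2 - lam * (y1 p - y2 p)^2 \<noteq> 0" if "p \<in> S" for p
    using assms(5) that by blast
  define w12 where "w12 = (\<lambda>p. w0 p + 24 * (\<eta>1 - \<eta>2) * (w1 p - w2 p)
    / ((w1 p - w2 p)^2 - lam * (y1 p - y2 p)^2))"
  define y12 where "y12 = (\<lambda>p. y0 p + - 24 * (\<eta>1 - \<eta>2) * (y1 p - y2 p)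
    / ((w1 p - w2 p)^2 - lam * (y1 p - y2 p)^2))"
  have w: "w12 p - w0 p = 24 * (\<eta>1 - \<eta>2) * (w1 p - w2 p)
      / ((w1 p - w2 p)^2 - lam * (y1 p - y2 p)^2)"
    and y: "y12 p - y0 p = - 24 * (\<eta>1 - \<eta>2) * (y1 p - y2 p)
      / ((w1 p - w2 p)^2 - lam * (y1 p - y2 p)^2)" for p
    by (simp_all add: w12_def y12_def)
  \<comment> \<open>The formula is invariant under exchanging the indices 1 and 2, so the same pair
    closes the square along both paths.\<close>
  have w': "w12 p - w0 p = 24 * (\<eta>2 - \<eta>1) * (w2 p - w1 p)
      / ((w2 p - w1 p)^2 - lam * (y2 p - y1 p)^2)"
    and y': "y12 p - y0 p = - 24 * (\<eta>2 - \<eta>1) * (y2 p - y1 p)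
      / ((w2 p - w1 p)^2 - lam * (y2 p - y1 p)^2)" for p
    unfolding w y power2_commute[of "w2 p"] power2_commute[of "y2 p"]
    by (simp_all add: algebra_simps)
  have b12: "baecklund_on lam S \<eta>2 w1 y1 w12 y12"
    by (rule superposition_baecklund[OF assms(1,3,4) nz w y])
  have b21: "baecklund_on lam S \<eta>1 w2 y2 w12 y12"
    by (rule superposition_baecklund[OF assms(1,4,3) _ w' y'])
      (use nz in \<open>simp add: power2_commute[of "w2 _"] power2_commute[of "y2 _"]\<close>)
  have "solution_on lam S w12 y12"
    by (rule baecklund_solution[OF assms(1) b12 baecklund_solution[OF assms(1,3,2)]])
  then have "\<exists>w12 y12 w21 y21.
        baecklund_on lam S \<eta>2 w1 y1 w12 y12 \<and> solution_on lam S w12 y12 \<and>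
        baecklund_on lam S \<eta>1 w2 y2 w21 y21 \<and> solution_on lam S w21 y21 \<and>
        (\<forall>p\<in>S. w12 p = w21 p \<and> y12 p = y21 p \<and>
          w12 p - w0 p = 24 * (\<eta>1 - \<eta>2) * (w1 p - w2 p)
                           / ((w1 p - w2 p)^2 - lam * (y1 p - y2 p)^2) \<and>
          y12 p - y0 p = - 24 * (\<eta>1 - \<eta>2) * (y1 p - y2 p)
                           / ((w1 p - w2 p)^2 - lam * (y1 p - y2 p)^2))"
    using b12 b21 w y by blast
  then show ?thesis
    using baecklund_square_superposition[OF assms(1) _ assms(3,4)] nz by blast
qed

end
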